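(* Let $r\ge 2$ and $k\ge 2$ be fixed integers and let $m=m(n)$ satisfy $n\ge m$ and $m\to\infty$ as $n\to\infty$. Then \[ \kappa_{r,2k}(m,n)\sim \frac{m}{k}\qquad (n\to\infty). \]
   Context: $K_{m,n}$ denotes the complete bipartite graph with vertex classes of sizes $m$ and $n$. An $r$-edge-coloring is a map $c:E(K_{m,n})\to[r]$ (not all colors need be used). A path is alternating if any two adjacent edges of it have different colors; the length of a path is its number of edges. Paths between two vertices are internally disjoint if they share no vertices other than their endpoints. $\kappa_{r,2k}(m,n)$ is the maximum $t$ such that there is an $r$-edge-coloring of $K_{m,n}$ in which every pair of distinct vertices of the class of size $n$ is connected by $t$ internally disjoint alternating paths of length $2k$. $f\sim g$ means $f/g\to 1$. *)

theory Defs
  imports Complex_Main "HOL-Library.Landau_Symbols"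
begin

type_synonym bvertex = "nat + nat"

definition Kbip_edges :: "nat \<Rightarrow> nat \<Rightarrow> bvertex set set" where
  "Kbip_edges m n = {{Inl i, Inr j} |i j. i < m \<and> j < n}"

definition edge_coloring :: "nat \<Rightarrow> 'a set set \<Rightarrow> ('a set \<Rightarrow> nat) \<Rightarrow> bool" where
  "edge_coloring r E c \<longleftrightarrow> (\<forall>e\<in>E. c e \<in> {1..r})"

text \<open>A path is given by its list of vertices, so its length is one less than the
  length of the list.\<close>

definition path_between :: "'a set set \<Rightarrow> 'a \<Rightarrow> 'a \<Rightarrow> nat \<Rightarrow> 'a list \<Rightarrow> bool" where
  "path_between E x y l p \<longleftrightarrow>
     length p = l + 1 \<and> distinct p \<and> hd p = x \<and> last p = y \<and>
     (\<forall>i<l. {p ! i, p ! (i + 1)} \<in> E)"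

definition alternating :: "('a set \<Rightarrow> nat) \<Rightarrow> 'a list \<Rightarrow> bool" where
  "alternating c p \<longleftrightarrow>
     (\<forall>i. i + 2 < length p \<longrightarrow>
        c {p ! i, p ! (i + 1)} \<noteq> c {p ! (i + 1), p ! (i + 2)})"

definition internally_disjoint :: "'a \<Rightarrow> 'a \<Rightarrow> 'a list set \<Rightarrow> bool" where
  "internally_disjoint x y P \<longleftrightarrow>
     (\<forall>p\<in>P. \<forall>q\<in>P. p \<noteq> q \<longrightarrow> set p \<inter> set q \<subseteq> {x, y})"

definition alt_connected ::
  "'a set set \<Rightarrow> ('a set \<Rightarrow> nat) \<Rightarrow> nat \<Rightarrow> nat \<Rightarrow> 'a \<Rightarrow> 'a \<Rightarrow> bool" where
  "alt_connected E c l t x y \<longleftrightarrow>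
     (\<exists>P. finite P \<and> card P = t \<and> internally_disjoint x y P \<and>
          (\<forall>p\<in>P. path_between E x y l p \<and> alternating c p))"

text \<open>The maximum is over a nonempty finite set whenever \<open>r \<ge> 1\<close> and \<open>n \<ge> 2\<close>. For
  \<open>n < 2\<close> there is no pair of distinct vertices, every \<open>t\<close> qualifies and the value is
  meaningless; this does not matter for asymptotics as \<open>n\<close> grows.\<close>

definition kappa :: "nat \<Rightarrow> nat \<Rightarrow> nat \<Rightarrow> nat \<Rightarrow> nat" where
  "kappa r l m n = Max {t. \<exists>c. edge_coloring r (Kbip_edges m n) c \<and>
     (\<forall>x \<in> Inr ` {..<n}. \<forall>y \<in> Inr ` {..<n}. x \<noteq> y \<longrightarrow>
        alt_connected (Kbip_edges m n) c l t x y)}"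

end

theory Submission imports Defs "HOL-Library.Disjoint_Sets" begin

text \<open>
  Each path uses \<open>k\<close> vertices of the class of size \<open>m\<close>, whence the upper bound \<open>m / k\<close>.

  For the lower bound, call a 2-coloring pseudorandom if every rectangle with sides at least
  \<open>\<epsilon> m\<close> contains edges of both colors. Fixing \<open>d\<close> large in terms of \<open>\<epsilon>\<close>, such a coloring is
  obtained by letting the columns run periodically through all subsets of \<open>{0, \<dots>, d - 1}\<close> and
  the rows through all elements, the color being membership: a subset is prescribed on
  \<open>\<epsilon> d / 4\<close> elements with frequency only \<open>2 powr (- \<epsilon> d / 4)\<close>. Each row is followed by its
  complement, so that all columns are balanced.

  Given end vertices \<open>x\<close> and \<open>y\<close>, choose two systems of pairwise disjoint layers
  \<open>V\<^sub>1, W\<^sub>1, V\<^sub>2, \<dots>, W\<^sub>k\<^sub>-\<^sub>1, V\<^sub>k\<close> of size \<open>m div 2k\<close>, one for each color of the first edge;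
  balancedness makes room for first layers joined to \<open>x\<close>, and last layers joined to \<open>y\<close>, in the
  right color. By pseudorandomness a maximal matching in the prescribed color between
  consecutive layers misses fewer than \<open>\<epsilon> m\<close> vertices, and concatenating the matchings yields
  all but \<open>O(\<epsilon> m)\<close> of the \<open>m / k\<close> paths.
\<close>

section \<open>Greedy matchings, disjoint transversals and disjoint subsets\<close>

text \<open>Greedy choice: while fewer than \<open>card A - e\<close> pairs are matched, at least
  \<open>e\<close> elements are free in \<open>A\<close>, and also in the no smaller
  \<open>B\<close>, so density yields a further pair.\<close>

lemma partial_matching:
  fixes R :: "'a \<Rightarrow> 'b \<Rightarrow> bool"
  assumes fin: "finite A" "finite B" and le: "card A \<le> card B"
    and dense: "\<And>X Y. X \<subseteq> A \<Longrightarrow> Y \<subseteq> B \<Longrightarrow> e \<le> card X \<Longrightarrow> e \<le> card Y \<Longrightarrow> \<exists>x\<in>X. \<exists>y\<in>Y. R x y"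
    and "j \<le> card A - e"
  shows "\<exists>A' f. A' \<subseteq> A \<and> card A' = j \<and> inj_on f A' \<and> f ` A' \<subseteq> B \<and> (\<forall>a\<in>A'. R a (f a))"
  using assms(5)
proof (induction j)
  case 0
  show ?case by (rule exI[of _ "{}"]) simp
next
  case (Suc j)
  then obtain A' f where A': "A' \<subseteq> A" "card A' = j" "inj_on f A'" "f ` A' \<subseteq> B" "\<forall>a\<in>A'. R a (f a)"
    by (meson Suc_leD)
  have finA': "finite A'" using A'(1) fin(1) finite_subset by blast
  have "card (A - A') = card A - j" using A' finA' by (simp add: card_Diff_subset)
  moreover have "card (B - f ` A') = card B - j"
    using A' finA' by (simp add: card_Diff_subset card_image)
  ultimately obtain a b where ab: "a \<in> A - A'" "b \<in> B - f ` A'" "R a b"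
    using dense[of "A - A'" "B - f ` A'"] Suc.prems le by fastforce
  have "inj_on (f(a := b)) (insert a A')"
    using A'(3) ab by (auto simp: inj_on_def)
  moreover have "f(a := b) ` insert a A' \<subseteq> B" using A'(4) ab by auto
  moreover have "\<forall>z\<in>insert a A'. R z ((f(a := b)) z)" using A'(5) ab by auto
  moreover have "card (insert a A') = Suc j" using ab finA' A'(2) by simp
  moreover have "insert a A' \<subseteq> A" using ab A'(1) by blast
  ultimately show ?case by blast
qed

text \<open>The ends of the partial transversals lie in \<open>L l\<close> and are matched into
  \<open>L (Suc l)\<close>; each such step loses \<open>e\<close> of them. The relation depends on
  \<open>i\<close> because the prescribed color changes from one pair of layers to the next.\<close>

lemma disjoint_transversals:
  fixes L :: "nat \<Rightarrow> 'a set" and E :: "nat \<Rightarrow> 'a \<Rightarrow> 'a \<Rightarrow> bool"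
  assumes "\<And>i. i \<le> l \<Longrightarrow> finite (L i) \<and> card (L i) = s"
    and "\<And>i j. i \<le> l \<Longrightarrow> j \<le> l \<Longrightarrow> i \<noteq> j \<Longrightarrow> L i \<inter> L j = {}"
    and "\<And>i X Y. i < l \<Longrightarrow> X \<subseteq> L i \<Longrightarrow> Y \<subseteq> L (Suc i) \<Longrightarrow> e \<le> card X \<Longrightarrow> e \<le> card Y
      \<Longrightarrow> \<exists>x\<in>X. \<exists>y\<in>Y. E i x y"
  shows "\<exists>P. finite P \<and> card P = s - l * e \<and>
    (\<forall>p\<in>P. length p = Suc l \<and> (\<forall>i\<le>l. p ! i \<in> L i) \<and> (\<forall>i<l. E i (p ! i) (p ! Suc i))) \<and>
    (\<forall>p\<in>P. \<forall>q\<in>P. p \<noteq> q \<longrightarrow> set p \<inter> set q = {})"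
  using assms
proof (induction l)
  case 0
  have "inj_on (\<lambda>v. [v]) (L 0)" by (simp add: inj_on_def)
  then show ?case using 0(1)[of 0]
    by (intro exI[of _ "(\<lambda>v. [v]) ` L 0"]) (auto simp: card_image)
next
  case (Suc l)
  have "\<exists>P. finite P \<and> card P = s - l * e \<and>
    (\<forall>p\<in>P. length p = Suc l \<and> (\<forall>i\<le>l. p ! i \<in> L i) \<and> (\<forall>i<l. E i (p ! i) (p ! Suc i))) \<and>
    (\<forall>p\<in>P. \<forall>q\<in>P. p \<noteq> q \<longrightarrow> set p \<inter> set q = {})"
  proof (rule Suc.IH)
    show "finite (L i) \<and> card (L i) = s" if "i \<le> l" for i
      using Suc.prems(1)[of i] that by simp
    show "L i \<inter> L j = {}" if "i \<le> l" "j \<le> l" "i \<noteq> j" for i j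
      using Suc.prems(2)[of i j] that by simp
    show "\<exists>x\<in>X. \<exists>y\<in>Y. E i x y"
      if "i < l" "X \<subseteq> L i" "Y \<subseteq> L (Suc i)" "e \<le> card X" "e \<le> card Y" for i X Y
      using Suc.prems(3)[of i X Y] that by simp
  qed
  then obtain P where P0: "finite P" "card P = s - l * e"
    "\<forall>p\<in>P. length p = Suc l \<and> (\<forall>i\<le>l. p ! i \<in> L i) \<and> (\<forall>i<l. E i (p ! i) (p ! Suc i))"
    "\<forall>p\<in>P. \<forall>q\<in>P. p \<noteq> q \<longrightarrow> set p \<inter> set q = {}"
    by (elim exE conjE)
  have P: "finite P" "card P = s - l * e"
    "\<And>p. p \<in> P \<Longrightarrow> length p = Suc l" "\<And>p i. p \<in> P \<Longrightarrow> i \<le> l \<Longrightarrow> p ! i \<in> L i"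
    "\<And>p i. p \<in> P \<Longrightarrow> i < l \<Longrightarrow> E i (p ! i) (p ! Suc i)"
    "\<And>p q. p \<in> P \<Longrightarrow> q \<in> P \<Longrightarrow> p \<noteq> q \<Longrightarrow> set p \<inter> set q = {}"
    using P0 by simp_all
  have last_in: "p ! l \<in> set p" if "p \<in> P" for p using P(3)[OF that] by simp
  \<comment> \<open>Disjoint transversals have different ends, so a matching of the ends
    \<open>T\<close> is a matching of the transversals themselves.\<close>
  have inj: "inj_on (\<lambda>p. p ! l) P"
    using P(6) last_in unfolding inj_on_def by (metis disjoint_iff)
  define T where "T = (\<lambda>p. p ! l) ` P"
  have T: "finite T" "card T = s - l * e" "T \<subseteq> L l"
    using P(1,2,4) inj by (auto simp: T_def card_image)
  have "\<exists>T' f. T' \<subseteq> T \<and> card T' = card T - e \<and> inj_on f T' \<and> f ` T' \<subseteq> L (Suc l)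
    \<and> (\<forall>a\<in>T'. E l a (f a))"
  proof (rule partial_matching[where e = e])
    show "finite (L (Suc l))" "card T \<le> card (L (Suc l))"
      using Suc.prems(1)[of "Suc l"] T(2) by auto
    show "\<exists>x\<in>X. \<exists>y\<in>Y. E l x y"
      if "X \<subseteq> T" "Y \<subseteq> L (Suc l)" "e \<le> card X" "e \<le> card Y" for X Y
      using Suc.prems(3)[of l X Y] T(3) that by auto
  qed (use T(1) in auto)
  then obtain T' f where T': "T' \<subseteq> T" "card T' = card T - e" "inj_on f T'" "f ` T' \<subseteq> L (Suc l)"
    "\<forall>a\<in>T'. E l a (f a)" by (elim exE conjE)
  define P0 where "P0 = {p \<in> P. p ! l \<in> T'}"
  have "(\<lambda>p. p ! l) ` P0 = T'" using T'(1) by (auto simp: P0_def T_def)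
  moreover have "inj_on (\<lambda>p. p ! l) P0" using inj by (auto simp: P0_def inj_on_def)
  ultimately have cP0: "card P0 = s - Suc l * e"
    using T'(2) T(2) card_image by fastforce
  define ext where "ext p = p @ [f (p ! l)]" for p
  have inje: "inj_on ext P0" by (auto simp: inj_on_def ext_def)
  have ext_disj: "set (ext p) \<inter> set (ext q) = {}" if pq: "p \<in> P0" "q \<in> P0" "p \<noteq> q" for p q
  proof -
    \<comment> \<open>The appended vertex lies in layer \<open>Suc l\<close>, which is disjoint from
      all layers that \<open>q\<close> visits.\<close>
    have new: "f (p ! l) \<notin> set q" if pq: "p \<in> P0" "q \<in> P0" for p q
    proof
      assume "f (p ! l) \<in> set q"
      then obtain i where "i \<le> l" "q ! i = f (p ! l)"
        using pq P(3)[of q] by (auto simp: in_set_conv_nth P0_def less_Suc_eq_le)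
      then have "f (p ! l) \<in> L i \<inter> L (Suc l)"
        using pq P(4)[of q i] T'(4) by (auto simp: P0_def)
      then show False using Suc.prems(2)[of i "Suc l"] \<open>i \<le> l\<close> by auto
    qed
    have "p ! l \<noteq> q ! l" using inj pq by (auto simp: P0_def inj_on_def)
    then have "f (p ! l) \<noteq> f (q ! l)" using T'(3) pq by (auto simp: P0_def inj_on_def)
    then show ?thesis using new[OF pq(1,2)] new[OF pq(2,1)] P(6)[of p q] pq
      by (auto simp: ext_def P0_def)
  qed
  have ext_ok: "length (ext p) = Suc (Suc l) \<and> (\<forall>i\<le>Suc l. ext p ! i \<in> L i) \<and>
      (\<forall>i<Suc l. E i (ext p ! i) (ext p ! Suc i))" if "p \<in> P0" for p
  proof -
    have "p \<in> P" "p ! l \<in> T'" using that by (auto simp: P0_def)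
    then show ?thesis using P(3-5)[of p] T'(4,5)
      by (auto simp: ext_def nth_append less_Suc_eq le_Suc_eq)
  qed
  show ?case
  proof (intro exI[of _ "ext ` P0"] conjI)
    show "finite (ext ` P0)" using P(1) by (simp add: P0_def)
    show "card (ext ` P0) = s - Suc l * e" using inje cP0 by (simp add: card_image)
    show "\<forall>p\<in>ext ` P0. \<forall>q\<in>ext ` P0. p \<noteq> q \<longrightarrow> set p \<inter> set q = {}"
      using ext_disj by blast
  qed (use ext_ok in auto)
qed

lemma ex_disjoint_subsets_card:
  assumes "finite I" "finite A" "card I * s \<le> card A"
  shows "\<exists>F. (\<forall>i\<in>I. F i \<subseteq> A \<and> card (F i) = s) \<and> disjoint_family_on F I"
  using assms(1,3)
proof (induction I rule: finite_induct)
  case empty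
  then show ?case by (auto simp: disjoint_family_on_def)
next
  case (insert x I)
  then obtain F where F: "\<forall>i\<in>I. F i \<subseteq> A \<and> card (F i) = s" "disjoint_family_on F I"
    by auto
  have "card (\<Union>i\<in>I. F i) \<le> (\<Sum>i\<in>I. card (F i))" by (rule card_UN_le[OF insert(1)])
  also have "\<dots> = card I * s" using F(1) by simp
  finally have "s \<le> card A - card (\<Union>i\<in>I. F i)" using insert by simp
  also have "\<dots> \<le> card (A - (\<Union>i\<in>I. F i))"
    by (rule diff_card_le_card_Diff) (use F assms(2) insert(1) in \<open>auto intro: finite_subset[of _ A]\<close>)
  finally obtain S where S: "S \<subseteq> A - (\<Union>i\<in>I. F i)" "card S = s"
    by (meson obtain_subset_with_card_n)
  then have "disjoint_family_on (F(x := S)) (insert x I)"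
    using F(2) insert(2) unfolding disjoint_family_on_def by auto
  moreover have "\<forall>i\<in>insert x I. (F(x := S)) i \<subseteq> A \<and> card ((F(x := S)) i) = s"
    using F(1) S by auto
  ultimately show ?case by blast
qed

section \<open>The pseudorandom 2-coloring\<close>

text \<open>A residue class modulo \<open>d\<close> has at most \<open>m div d + 1\<close> members
  below \<open>m\<close>, since residue and quotient determine a number.\<close>

lemma card_le_card_image_mod:
  fixes d :: nat
  assumes "A \<subseteq> {..<m}"
  shows "card A \<le> card ((\<lambda>i. i mod d) ` A) * (m div d + 1)"
proof -
  have fin: "finite A" using assms finite_subset by blast
  have "inj_on (\<lambda>i. (i mod d, i div d)) A"
    by (metis (mono_tags, lifting) inj_onI div_mult_mod_eq prod.inject)
  moreover have "(\<lambda>i. (i mod d, i div d)) ` A \<subseteq> ((\<lambda>i. i mod d) ` A) \<times> {..m div d}"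
    using assms by (auto intro!: div_le_mono)
  ultimately have "card A \<le> card (((\<lambda>i. i mod d) ` A) \<times> {..m div d})"
    using fin by (intro card_inj_on_le) auto
  then show ?thesis by (simp add: card_cartesian_product)
qed

lemma card_le_card_image_div2:
  fixes A :: "nat set"
  assumes "finite A"
  shows "card A \<le> 2 * card ((\<lambda>i. i div 2) ` A)"
proof -
  have "inj_on (\<lambda>i::nat. (i mod 2, i div 2)) A"
    by (metis (mono_tags, lifting) inj_onI div_mult_mod_eq prod.inject)
  moreover have "(\<lambda>i. (i mod 2, i div 2)) ` A \<subseteq> {..<2} \<times> ((\<lambda>i. i div 2) ` A)" by auto
  ultimately have "card A \<le> card ({..<2::nat} \<times> ((\<lambda>i. i div 2) ` A))"
    using assms by (intro card_inj_on_le) auto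
  then show ?thesis by (simp add: card_cartesian_product)
qed

text \<open>If a rectangle \<open>X\<close>, \<open>Y\<close> misses the value \<open>b\<close>, its
  rows represent a set \<open>R\<close> of \<open>u\<close> elements, with \<open>u\<close> at least
  \<open>\<epsilon> * d / 4\<close>, and all its columns carry subsets with the same trace on
  \<open>R\<close>. Only \<open>2 ^ (d - u)\<close> subsets remain, too few for \<open>Y\<close> to
  be large.\<close>

lemma pseudorandom_bicoloring:
  fixes \<epsilon> :: real
  assumes "\<epsilon> > 0"
  shows "\<exists>m0. \<forall>m\<ge>m0. \<exists>Q :: nat \<Rightarrow> nat \<Rightarrow> bool.
    (\<forall>p j. Q (2 * p) j \<noteq> Q (2 * p + 1) j) \<and>
    (\<forall>X Y b. X \<subseteq> {..<m} \<longrightarrow> Y \<subseteq> {..<m} \<longrightarrow> \<epsilon> * m \<le> card X \<longrightarrow> \<epsilon> * m \<le> card Y \<longrightarrow>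
      (\<exists>i\<in>X. \<exists>j\<in>Y. Q i j = b))"
proof -
  \<comment> \<open>With this \<open>d\<close>, the bound \<open>\<epsilon> * d \<le> 4 * u\<close>
    gives \<open>\<epsilon> * u > 2\<close>, which contradicts
    \<open>\<epsilon> * 2 ^ u \<le> 2\<close>.\<close>
  obtain d :: nat where d: "8 / \<epsilon>\<^sup>2 < d" using reals_Archimedean2 by blast
  have d0: "d > 0"
    using d assms
    by (metis divide_pos_pos less_trans of_nat_0_less_iff zero_less_numeral zero_less_power)
  have "card (Pow {..<d}) = 2 ^ d" by (simp add: card_Pow)
  then obtain h where h: "bij_betw h {..<2 ^ d :: nat} (Pow {..<d})"
    using ex_bij_betw_nat_finite[of "Pow {..<d}"]
    by (metis atLeast0LessThan finite_Pow_iff finite_lessThan)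
  \<comment> \<open>Rows \<open>2 * p\<close> and \<open>2 * p + 1\<close> stand for the same
    element \<open>p mod d\<close>; the parity of the row negates membership, so the two rows are
    complementary.\<close>
  define Q where "Q i j \<longleftrightarrow> ((i div 2 mod d \<in> h (j mod 2 ^ d)) = even i)" for i j :: nat
  \<comment> \<open>Such a large \<open>m\<close> absorbs the rounding: \<open>m div d + 1\<close>
    and \<open>m div 2 ^ d + 1\<close> are at most twice \<open>m / d\<close> and
    \<open>m / 2 ^ d\<close>.\<close>
  have "\<exists>i\<in>X. \<exists>j\<in>Y. Q i j = b"
    if m: "m \<ge> 2 * d + 2 ^ d" and XY: "X \<subseteq> {..<m}" "Y \<subseteq> {..<m}" "\<epsilon> * m \<le> card X" "\<epsilon> * m \<le> card Y"
    for m X Y b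
  proof (rule ccontr)
    assume neg: "\<not> ?thesis"
    define R where "R = (\<lambda>i. i div 2 mod d) ` X"
    define u where "u = card R"
    have fin: "finite X" "finite Y" using XY finite_subset by blast+
    have m0: "m > 0" using m d0 by simp
    have "card X \<le> 2 * card ((\<lambda>i. i div 2) ` X)" by (rule card_le_card_image_div2[OF fin(1)])
    also have "card ((\<lambda>i. i div 2) ` X) \<le> card ((\<lambda>i. i mod d) ` (\<lambda>i. i div 2) ` X) * (m div d + 1)"
      by (rule card_le_card_image_mod) (use XY in \<open>auto intro: le_less_trans[OF div_le_dividend]\<close>)
    also have "(\<lambda>i. i mod d) ` (\<lambda>i. i div 2) ` X = R" by (auto simp: R_def image_image)
    finally have "card X \<le> 2 * u * (m div d + 1)" by (simp add: u_def)
    then have "real (card X) \<le> real (2 * u * (m div d + 1))" by (simp only: of_nat_le_iff)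
    also have "\<dots> = 2 * real u * (real (m div d) + 1)" by (simp add: algebra_simps)
    also have "real (m div d) + 1 \<le> 2 * m / d"
    proof -
      have "real (m div d) \<le> m / d" by (rule of_nat_div_le_of_nat)
      moreover have "1 \<le> real m / d" using m d0 by simp
      ultimately show ?thesis by simp
    qed
    finally have "\<epsilon> * m \<le> 2 * real u * (2 * m / d)" using XY(3) by (simp add: mult_left_mono)
    then have "\<epsilon> * m \<le> (4 * u / d) * m" by (simp add: mult_ac)
    then have "\<epsilon> \<le> 4 * u / d" using m0 by (simp only: mult_le_cancel_right_pos of_nat_0_less_iff)
    then have u1: "\<epsilon> * d \<le> 4 * u" using d0 by (simp add: pos_le_divide_eq)
    have Rd: "R \<subseteq> {..<d}" using d0 by (auto simp: R_def)
    have "\<forall>\<rho>\<in>R. \<exists>i. i \<in> X \<and> i div 2 mod d = \<rho>" by (auto simp: R_def)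
    from bchoice[OF this] obtain g where g: "\<forall>\<rho>\<in>R. g \<rho> \<in> X \<and> g \<rho> div 2 mod d = \<rho>" ..
    \<comment> \<open>The right-hand side does not depend on the column \<open>j\<close>: this is
      the common trace on \<open>R\<close>.\<close>
    have mem: "\<rho> \<in> h (j mod 2 ^ d) \<longleftrightarrow> (even (g \<rho>) \<noteq> b)" if "\<rho> \<in> R" "j \<in> Y" for \<rho> j
    proof -
      have "g \<rho> \<in> X" "g \<rho> div 2 mod d = \<rho>" using g that(1) by auto
      moreover from this(1) have "Q (g \<rho>) j \<noteq> b" using neg that(2) by auto
      ultimately show ?thesis by (auto simp: Q_def)
    qed
    define Z where "Z = (\<lambda>j. j mod 2 ^ d) ` Y"
    have Zsub: "Z \<subseteq> {..<2 ^ d}" by (auto simp: Z_def)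
    have hsub: "h z \<subseteq> {..<d}" if "z \<in> Z" for z
      using h Zsub that by (auto simp: bij_betw_def)
    have "inj_on (\<lambda>z. h z - R) Z"
    proof (rule inj_onI)
      fix z w assume zw: "z \<in> Z" "w \<in> Z" "h z - R = h w - R"
      have "h z \<inter> R = h w \<inter> R" using mem zw(1,2) by (auto simp: Z_def)
      then have "h z = h w" using zw(3) by blast
      then show "z = w" using inj_onD[OF bij_betw_imp_inj_on[OF h]] Zsub zw by blast
    qed
    then have "card Z \<le> card (Pow ({..<d} - R))"
      by (rule card_inj_on_le) (use hsub in \<open>auto\<close>)
    also have "\<dots> = 2 ^ (d - u)" using Rd by (simp add: card_Pow card_Diff_subset u_def finite_subset)
    finally have cZ: "card Z \<le> 2 ^ (d - u)" .
    have ud: "u \<le> d" using card_mono[OF _ Rd] by (simp add: u_def)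
    have "card Y \<le> card Z * (m div 2 ^ d + 1)"
      unfolding Z_def by (rule card_le_card_image_mod[OF XY(2)])
    also have "\<dots> \<le> 2 ^ (d - u) * (m div 2 ^ d + 1)" using cZ by (rule mult_right_mono) simp
    finally have "real (card Y) \<le> real (2 ^ (d - u) * (m div 2 ^ d + 1))"
      by (simp only: of_nat_le_iff)
    also have "\<dots> = 2 ^ (d - u) * (real (m div 2 ^ d) + 1)" by (simp add: algebra_simps)
    also have "\<dots> \<le> 2 ^ (d - u) * (2 * m / 2 ^ d)"
    proof -
      have "real (m div 2 ^ d) \<le> m / 2 ^ d" using of_nat_div_le_of_nat[of m "2 ^ d"] by simp
      moreover have "real (2 ^ d) \<le> real m" using m by (simp only: of_nat_le_iff)
      then have "1 \<le> real m / 2 ^ d" by simp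
      ultimately have "real (m div 2 ^ d) + 1 \<le> 2 * m / 2 ^ d" by linarith
      then show ?thesis by (rule mult_left_mono) simp
    qed
    also have "\<dots> = 2 * m / 2 ^ u" using ud by (simp add: power_diff)
    finally have "\<epsilon> * m \<le> 2 * m / 2 ^ u" using XY(4) by linarith
    then have "\<epsilon> * 2 ^ u \<le> 2" using m0 by (simp add: field_simps)
    moreover have "\<epsilon> * u < \<epsilon> * 2 ^ u" using assms of_nat_less_two_power[of u] by simp
    ultimately have "\<epsilon> * u < 2" by linarith
    moreover have "\<epsilon> * (\<epsilon> * d) \<le> \<epsilon> * (4 * u)" using u1 assms by (intro mult_left_mono) auto
    ultimately have "\<epsilon>\<^sup>2 * d < 8" by (simp add: power2_eq_square)
    then show False using d assms by (simp add: field_simps)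
  qed
  moreover have "Q (2 * p) j \<noteq> Q (2 * p + 1) j" for p j by (simp add: Q_def)
  ultimately show ?thesis
    by (intro exI[of _ "2 * d + 2 ^ d"] exI[of _ Q] allI impI conjI)
qed

section \<open>The upper bound from counting vertices of the class of size \<open>m\<close>\<close>

lemma doubleton_in_Kbip_edges:
  "{u, v} \<in> Kbip_edges m n \<longleftrightarrow>
    (\<exists>i j. i < m \<and> j < n \<and> (u = Inl i \<and> v = Inr j \<or> u = Inr j \<and> v = Inl i))"
  by (auto simp: Kbip_edges_def doubleton_eq_iff)

lemma path_Kbip_nth:
  assumes "path_between (Kbip_edges m n) (Inr x) y l p" "i \<le> l"
  shows "p ! i \<in> (if even i then range Inr else Inl ` {..<m})"
  using assms(2)
proof (induction i)
  case 0
  have "p ! 0 = Inr x" using assms(1) by (cases p) (auto simp: path_between_def)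
  then show ?case by simp
next
  case (Suc i)
  then have "{p ! i, p ! Suc i} \<in> Kbip_edges m n" using assms(1) by (auto simp: path_between_def)
  then show ?case using Suc by (auto simp: doubleton_in_Kbip_edges split: if_splits)
qed

text \<open>The \<open>k\<close> odd positions of each path are vertices of the class of size
  \<open>m\<close>, and different paths use different ones.\<close>

lemma alt_connected_Kbip_bound:
  assumes "alt_connected (Kbip_edges m n) c (2 * k) t (Inr x) (Inr y)"
  shows "t * k \<le> m"
proof -
  obtain P where P: "finite P" "card P = t" "internally_disjoint (Inr x) (Inr y) P"
    "\<forall>p\<in>P. path_between (Kbip_edges m n) (Inr x) (Inr y) (2 * k) p"
    using assms by (auto simp: alt_connected_def)
  define N where "N p = set p \<inter> Inl ` {..<m}" for p :: "bvertex list"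
  have "k \<le> card (N p)" if "p \<in> P" for p
  proof -
    have p: "path_between (Kbip_edges m n) (Inr x) (Inr y) (2 * k) p" using P that by blast
    have "inj_on (\<lambda>j. p ! (2 * j + 1)) {..<k}"
      using p by (auto simp: inj_on_def path_between_def nth_eq_iff_index_eq)
    moreover have "(\<lambda>j. p ! (2 * j + 1)) ` {..<k} \<subseteq> N p"
    proof
      fix v assume "v \<in> (\<lambda>j. p ! (2 * j + 1)) ` {..<k}"
      then obtain j where j: "j < k" "v = p ! (2 * j + 1)" by auto
      then have "v \<in> set p" using p by (auto simp: path_between_def)
      then show "v \<in> N p" using path_Kbip_nth[OF p, of "2 * j + 1"] j by (simp add: N_def)
    qed
    ultimately have "card {..<k} \<le> card (N p)" by (rule card_inj_on_le) (simp add: N_def)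
    then show ?thesis by simp
  qed
  then have "(\<Sum>p\<in>P. k) \<le> (\<Sum>p\<in>P. card (N p))" by (rule sum_mono)
  \<comment> \<open>The shared endpoints are \<open>Inr\<close> vertices, so internal disjointness
    makes the sets \<open>N p\<close> fully disjoint.\<close>
  also have "\<dots> = card (\<Union>p\<in>P. N p)"
    using P(1,3) by (intro card_UN_disjoint[symmetric]) (fastforce simp: N_def internally_disjoint_def)+
  also have "\<dots> \<le> card (Inl ` {..<m} :: bvertex set)"
    by (rule card_mono) (auto simp: N_def)
  also have "\<dots> = m" by (simp add: card_image)
  finally show ?thesis using P(2) by simp
qed

section \<open>Alternating paths in a pseudorandom coloring\<close>

text \<open>Each pair \<open>2 * p\<close>, \<open>2 * p + 1\<close> contains exactly one number
  with value \<open>g\<close>, namely \<open>h p\<close>.\<close>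

lemma card_balanced:
  fixes f :: "nat \<Rightarrow> bool"
  assumes "\<And>p. f (2 * p) \<noteq> f (2 * p + 1)"
  shows "b - a \<le> card {i \<in> {2 * a..<2 * b}. f i = g}"
proof -
  define h where "h p = (if f (2 * p) = g then 2 * p else 2 * p + 1)" for p
  have "h p div 2 = p" for p by (simp add: h_def)
  then have "inj_on h {a..<b}" by (metis inj_onI)
  moreover have "h ` {a..<b} \<subseteq> {i \<in> {2 * a..<2 * b}. f i = g}"
  proof
    fix i assume "i \<in> h ` {a..<b}"
    then obtain p where "a \<le> p" "p < b" "i = h p" by auto
    then show "i \<in> {i \<in> {2 * a..<2 * b}. f i = g}" using assms[of p] by (auto simp: h_def)
  qed
  ultimately have "card {a..<b} \<le> card {i \<in> {2 * a..<2 * b}. f i = g}"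
    by (rule card_inj_on_le) simp
  then show ?thesis by simp
qed

text \<open>Each of the two systems has \<open>2 * k - 1\<close> layers of size \<open>s\<close>,
  hence \<open>2 * k - 2\<close> matchings, each losing \<open>e\<close> paths. Column layers are
  taken below \<open>m\<close>, where density is available.\<close>

lemma alt_connected_of_pseudorandom:
  fixes Q :: "nat \<Rightarrow> nat \<Rightarrow> bool" and c :: "bvertex set \<Rightarrow> nat"
  assumes k: "k \<ge> 2" and mn: "m \<le> n" and s: "s = m div (2 * k)" "s \<ge> 1"
    and c: "\<And>i j. c {Inl i, Inr j} = (if Q i j then 1 else 2)"
    and bal: "\<And>p j. Q (2 * p) j \<noteq> Q (2 * p + 1) j"
    and dense: "\<And>X Y b. X \<subseteq> {..<m} \<Longrightarrow> Y \<subseteq> {..<m} \<Longrightarrow> e \<le> card X \<Longrightarrow> e \<le> card Y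
      \<Longrightarrow> \<exists>i\<in>X. \<exists>j\<in>Y. Q i j = b"
    and xy: "x < n" "y < n" "x \<noteq> y"
  shows "alt_connected (Kbip_edges m n) c (2 * k) (2 * (s - (2 * k - 2) * e)) (Inr x) (Inr y)"
proof -
  txt \<open>First layers are taken from the rows below \<open>2 * q\<close> and last layers from the following
    \<open>2 * q\<close> rows, so they cannot collide.\<close>
  define q where "q = m div 4"
  \<comment> \<open>A block of \<open>2 * q\<close> rows has at least \<open>q\<close> rows of
    either value in a given column, enough for a layer.\<close>
  have sq: "s \<le> q" unfolding s(1) q_def by (rule div_le_mono2) (use k in auto)
  have qm: "4 * q \<le> m" by (simp add: q_def)
  have sm: "2 * k * s \<le> m" by (simp add: s(1))
  have "\<forall>g. \<exists>S. S \<subseteq> {i \<in> {2 * 0..<2 * q}. Q i x = g} \<and> card S = s"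
  proof
    fix g
    have "s \<le> card {i \<in> {2 * 0..<2 * q}. Q i x = g}"
      using card_balanced[of "\<lambda>i. Q i x" q 0 g] bal sq by simp
    then show "\<exists>S. S \<subseteq> {i \<in> {2 * 0..<2 * q}. Q i x = g} \<and> card S = s"
      by (meson obtain_subset_with_card_n)
  qed
  from choice[OF this] obtain S where
    S: "\<forall>g. S g \<subseteq> {i \<in> {2 * 0..<2 * q}. Q i x = g} \<and> card (S g) = s" ..
  have "\<forall>g. \<exists>S. S \<subseteq> {i \<in> {2 * q..<2 * (2 * q)}. Q i y = (\<not> g)} \<and> card S = s"
  proof
    fix g
    have "s \<le> card {i \<in> {2 * q..<2 * (2 * q)}. Q i y = (\<not> g)}"
      using card_balanced[of "\<lambda>i. Q i y" "2 * q" q "\<not> g"] bal sq by simp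
    then show "\<exists>S. S \<subseteq> {i \<in> {2 * q..<2 * (2 * q)}. Q i y = (\<not> g)} \<and> card S = s"
      by (meson obtain_subset_with_card_n)
  qed
  from choice[OF this] obtain T where
    T: "\<forall>g. T g \<subseteq> {i \<in> {2 * q..<2 * (2 * q)}. Q i y = (\<not> g)} \<and> card (T g) = s" ..
  have S2: "i < 2 * q \<and> Q i x = g" if "i \<in> S g" for i g
    using S[rule_format, of g] that by auto
  have T2: "2 * q \<le> i \<and> i < 4 * q \<and> Q i y = (\<not> g)" if "i \<in> T g" for i g
    using T[rule_format, of g] that by auto
  have Sm: "S g \<subseteq> {..<m}" and Tm: "T g \<subseteq> {..<m}" for g
    using S2[of _ g] T2[of _ g] qm by force+
  define D where "D = (S True \<union> S False) \<union> (T True \<union> T False)"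
  have D: "D \<subseteq> {..<m}" using Sm Tm by (auto simp: D_def)
  have "card D \<le> card (S True \<union> S False) + card (T True \<union> T False)"
    unfolding D_def by (rule card_Un_le)
  also have "\<dots> \<le> (card (S True) + card (S False)) + (card (T True) + card (T False))"
    by (intro add_mono card_Un_le)
  finally have cD: "card D \<le> 4 * s" using S T by simp
  \<comment> \<open>Inner row layers \<open>1, ..., k - 2\<close> of both systems: together with the
    four first and last layers they take \<open>2 * k * s \<le> m\<close> rows.\<close>
  define IF where "IF = (UNIV :: bool set) \<times> {1..<k - 1}"
  \<comment> \<open>All \<open>k - 1\<close> column layers of both systems take
    \<open>2 * k * s - 2 * s\<close> columns; as \<open>s \<ge> 1\<close>, room is left for avoiding
    \<open>x\<close> and \<open>y\<close>.\<close>
  define IW where "IW = (UNIV :: bool set) \<times> {..<k - 1}"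
  have "card IF * s \<le> card ({..<m} - D)"
  proof -
    have "card IF * s + 4 * s = 2 * k * s"
      using k by (auto simp: IF_def card_cartesian_product algebra_simps le_iff_add)
    then show ?thesis using cD sm D by (simp add: card_Diff_subset finite_subset)
  qed
  then have "\<exists>F. (\<forall>i\<in>IF. F i \<subseteq> {..<m} - D \<and> card (F i) = s) \<and> disjoint_family_on F IF"
    by (intro ex_disjoint_subsets_card) (auto simp: IF_def)
  then obtain F where
    F: "\<forall>i\<in>IF. F i \<subseteq> {..<m} - D \<and> card (F i) = s" "disjoint_family_on F IF" by blast
  have "card IW * s \<le> card ({..<m} - {x, y})"
  proof -
    have "card IW * s + 2 * s = 2 * k * s"
      using k by (auto simp: IW_def card_cartesian_product algebra_simps le_iff_add)
    moreover have "m - 2 \<le> card ({..<m} - {x, y})"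
      using diff_card_le_card_Diff[of "{x, y}" "{..<m}"] xy by simp
    ultimately show ?thesis using sm s(2) by linarith
  qed
  then have "\<exists>F. (\<forall>i\<in>IW. F i \<subseteq> {..<m} - {x, y} \<and> card (F i) = s) \<and> disjoint_family_on F IW"
    by (intro ex_disjoint_subsets_card) (auto simp: IW_def)
  then obtain W where
    W: "\<forall>i\<in>IW. W i \<subseteq> {..<m} - {x, y} \<and> card (W i) = s" "disjoint_family_on W IW" by blast
  txt \<open>The flag \<open>g\<close> tells the layer systems apart: a path of system \<open>g\<close> starts with an edge on
    which \<open>Q\<close> has value \<open>g\<close>, and ends with one on which it has value \<open>\<not> g\<close>.\<close>
  define V where "V g j = (if j = 0 then S g else if j = k - 1 then T g else F (g, j))" for g j
  have V: "V g j \<subseteq> {..<m} \<and> card (V g j) = s" if "j < k" for g j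
  proof -
    have "F (g, j) \<subseteq> {..<m} \<and> card (F (g, j)) = s" if "j \<noteq> 0" "j \<noteq> k - 1"
    proof -
      have "(g, j) \<in> IF" using that \<open>j < k\<close> by (auto simp: IF_def)
      then show ?thesis using F(1) by blast
    qed
    then show ?thesis using Sm[of g] Tm[of g] S T by (simp add: V_def)
  qed
  have Vdisj: "V g j \<inter> V g' j' = {}" if "j < k" "j' < k" "(g, j) \<noteq> (g', j')" for g g' j j'
  proof -
    have SS: "S g \<inter> S g' = {}" if "g \<noteq> g'" for g g' using S2[of _ g] S2[of _ g'] that by blast
    have TT: "T g \<inter> T g' = {}" if "g \<noteq> g'" for g g' using T2[of _ g] T2[of _ g'] that by blast
    have ST: "S g \<inter> T g' = {}" for g g'
      using S2[of _ g] T2[of _ g'] by (meson disjoint_iff not_less)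
    have inD: "S g \<subseteq> D" "T g \<subseteq> D" for g by (cases g; auto simp: D_def)+
    have FD: "F (g, j) \<inter> D = {}" if "j \<noteq> 0" "j \<noteq> k - 1" "j < k" for g j
    proof -
      have "(g, j) \<in> IF" using that by (auto simp: IF_def)
      then show ?thesis using F(1) by blast
    qed
    have FF: "F (g, j) \<inter> F (g', j') = {}" if "j \<noteq> 0" "j \<noteq> k - 1" "j' \<noteq> 0" "j' \<noteq> k - 1"
      using that \<open>j < k\<close> \<open>j' < k\<close> \<open>(g, j) \<noteq> (g', j')\<close>
      by (intro disjoint_family_onD[OF F(2)]) (auto simp: IF_def)
    show ?thesis
      using that SS[of g g'] TT[of g g'] ST[of g g'] ST[of g' g] inD[of g] inD[of g']
        FD[of j g] FD[of j' g'] FF k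
      unfolding V_def by (cases "j = 0"; cases "j = k - 1"; cases "j' = 0"; cases "j' = k - 1") auto
  qed
  define L :: "bool \<Rightarrow> nat \<Rightarrow> bvertex set" where
    "L g i = (if even i then Inl ` V g (i div 2) else Inr ` W (g, i div 2))" for g i
  define l where "l = 2 * k - 2"
  have half: "i div 2 < k" "odd i \<Longrightarrow> i div 2 < k - 1" if "i \<le> l" for i
    using that k unfolding l_def by presburger+
  have W': "W (g, i div 2) \<subseteq> {..<m} - {x, y} \<and> card (W (g, i div 2)) = s" if "i \<le> l" "odd i" for g i
  proof -
    have "(g, i div 2) \<in> IW" using half(2)[OF that] by (simp add: IW_def)
    then show ?thesis using W(1) by blast
  qed
  have Ldisj: "L g i \<inter> L g' i' = {}" if "i \<le> l" "i' \<le> l" "(g, i) \<noteq> (g', i')" for g g' i i'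
  proof (cases "even i = even i'")
    case True
    then have "i = i'" if "i div 2 = i' div 2" using that by presburger
    then have ne: "(g, i div 2) \<noteq> (g', i' div 2)" using that(3) by blast
    show ?thesis
    proof (cases "even i")
      case ev: True
      then show ?thesis using Vdisj[OF half(1)[OF that(1)] half(1)[OF that(2)] ne] True
        by (auto simp: L_def)
    next
      case od: False
      have "W (g, i div 2) \<inter> W (g', i' div 2) = {}"
        using disjoint_family_onD[OF W(2) _ _ ne] half(2)[OF that(1)] half(2)[OF that(2)] od True
        by (simp add: IW_def)
      then show ?thesis using od True by (auto simp: L_def)
    qed
  next
    case False
    then show ?thesis by (auto simp: L_def)
  qed
  have Lcard: "finite (L g i) \<and> card (L g i) = s" if "i \<le> l" for g i
  proof -
    have "finite (V g (i div 2))" using V[OF half(1)[OF that], of g] finite_subset by blast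
    moreover have "finite (W (g, i div 2))" if "odd i"
      using W'[OF \<open>i \<le> l\<close> that, of g] finite_subset[of _ "{..<m}"] by blast
    ultimately show ?thesis using V[OF half(1)[OF that], of g] W'[OF that, of g]
      by (simp add: L_def card_image)
  qed
  have Lxy: "Inr x \<notin> L g i" "Inr y \<notin> L g i" if "i \<le> l" for g i
    using W'[OF that, of g] by (auto simp: L_def split: if_splits)
  \<comment> \<open>This is the color of edge \<open>i\<close> of the full path. Edge 0 leaves
    \<open>x\<close>, so the edge from layer \<open>i\<close> to the next one has index
    \<open>Suc i\<close>.\<close>
  define col :: "bool \<Rightarrow> nat \<Rightarrow> nat" where "col g i = (if g = even i then 1 else 2)" for g i
  define E where "E g i u v \<longleftrightarrow> {u, v} \<in> Kbip_edges m n \<and> c {u, v} = col g i" for g i u v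
  have E_lr: "E g i (Inl a) (Inr b)" and E_rl: "E g i (Inr b) (Inl a)"
    if "a < m" "b < n" "Q a b = (g = even i)" for g i a b
    using that c[of a b] by (auto simp: E_def doubleton_in_Kbip_edges col_def insert_commute)
  have Ldense: "\<exists>u\<in>X. \<exists>v\<in>Y. E g (Suc i) u v"
    if i: "i < l" and XY: "X \<subseteq> L g i" "Y \<subseteq> L g (Suc i)" "e \<le> card X" "e \<le> card Y" for g i X Y
  proof (cases "even i")
    case True
    obtain X' Y' where X': "X = Inl ` X'" "X' \<subseteq> V g (i div 2)"
      and Y': "Y = Inr ` Y'" "Y' \<subseteq> W (g, Suc i div 2)"
      using XY(1,2) True by (auto simp: L_def subset_image_iff)
    have sub: "X' \<subseteq> {..<m}" "Y' \<subseteq> {..<m}"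
      using X'(2) Y'(2) V[OF half(1), of i g] W'[of "Suc i" g] i True by fastforce+
    then obtain a b where "a \<in> X'" "b \<in> Y'" "Q a b = (g = even (Suc i))"
      using dense[of X' Y' "g = even (Suc i)"] XY(3,4) X'(1) Y'(1)
      by (simp only: card_image inj_Inl inj_Inr) blast
    moreover from this have "a < m" "b < n" using sub mn by auto
    ultimately show ?thesis using E_lr[of a b g "Suc i"] X'(1) Y'(1) by blast
  next
    case False
    obtain X' Y' where X': "X = Inr ` X'" "X' \<subseteq> W (g, i div 2)"
      and Y': "Y = Inl ` Y'" "Y' \<subseteq> V g (Suc i div 2)"
      using XY(1,2) False by (auto simp: L_def subset_image_iff)
    have sub: "X' \<subseteq> {..<m}" "Y' \<subseteq> {..<m}"
      using X'(2) Y'(2) V[OF half(1), of "Suc i" g] W'[of i g] i False by fastforce+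
    then obtain a b where "a \<in> Y'" "b \<in> X'" "Q a b = (g = even (Suc i))"
      using dense[of Y' X' "g = even (Suc i)"] XY(3,4) X'(1) Y'(1)
      by (simp only: card_image inj_Inl inj_Inr) blast
    moreover from this have "a < m" "b < n" using sub mn by auto
    ultimately show ?thesis using E_rl[of a b g "Suc i"] X'(1) Y'(1) by blast
  qed
  have "\<forall>g. \<exists>P. finite P \<and> card P = s - l * e \<and>
    (\<forall>p\<in>P. length p = Suc l \<and> (\<forall>i\<le>l. p ! i \<in> L g i) \<and> (\<forall>i<l. E g (Suc i) (p ! i) (p ! Suc i))) \<and>
    (\<forall>p\<in>P. \<forall>q\<in>P. p \<noteq> q \<longrightarrow> set p \<inter> set q = {})"
  proof (intro allI disjoint_transversals)
    show "L g i \<inter> L g j = {}" if "i \<le> l" "j \<le> l" "i \<noteq> j" for g i j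
      using Ldisj that by blast
  qed (fact Lcard Ldense)+
  from choice[OF this] obtain P where P: "\<forall>g. finite (P g) \<and> card (P g) = s - l * e \<and>
    (\<forall>p\<in>P g. length p = Suc l \<and> (\<forall>i\<le>l. p ! i \<in> L g i) \<and> (\<forall>i<l. E g (Suc i) (p ! i) (p ! Suc i))) \<and>
    (\<forall>p\<in>P g. \<forall>q\<in>P g. p \<noteq> q \<longrightarrow> set p \<inter> set q = {})" ..
  have Pcard: "finite (P g)" "card (P g) = s - l * e" for g using P by simp_all
  have Pdisj1: "\<forall>p\<in>P g. \<forall>q\<in>P g. p \<noteq> q \<longrightarrow> set p \<inter> set q = {}" for g
    using spec[OF P, of g] by (elim conjE)
  have Plen: "length p = Suc l" and PL: "i \<le> l \<Longrightarrow> p ! i \<in> L g i"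
    and PE: "i < l \<Longrightarrow> E g (Suc i) (p ! i) (p ! Suc i)" if "p \<in> P g" for p g i
    using P that by simp_all
  have Pset: "set p \<subseteq> (\<Union>i\<le>l. L g i)" if p: "p \<in> P g" for p g
  proof
    fix v assume "v \<in> set p"
    then obtain i where "i \<le> l" "v = p ! i"
      using Plen[OF p] by (auto simp: in_set_conv_nth less_Suc_eq_le)
    then show "v \<in> (\<Union>i\<le>l. L g i)" using PL[OF p] by blast
  qed
  have Pdisj: "set p \<inter> set p' = {}" if "p \<in> P g" "p' \<in> P g'" "p \<noteq> p'" for p p' g g'
  proof (cases "g = g'")
    case True
    then show ?thesis using Pdisj1[of g] that by blast
  next
    case False
    then have "L g i \<inter> L g' i' = {}" if "i \<le> l" "i' \<le> l" for i i'
      using Ldisj[OF that, of g g'] by simp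
    then have "(\<Union>i\<le>l. L g i) \<inter> (\<Union>i\<le>l. L g' i) = {}" by blast
    then show ?thesis using Pset[OF that(1)] Pset[OF that(2)] by blast
  qed
  \<comment> \<open>\<open>Pdisj\<close> only concerns distinct lists; this excludes a list that is
    in both systems and would be counted twice.\<close>
  have "P True \<inter> P False = {}"
  proof (rule ccontr)
    assume "P True \<inter> P False \<noteq> {}"
    then obtain p where "p \<in> P True" "p \<in> P False" by blast
    then have "p ! 0 \<in> L True 0 \<inter> L False 0" using PL by blast
    then show False using Ldisj[of 0 0 True False] by simp
  qed
  then have cU: "card (P True \<union> P False) = 2 * (s - l * e)"
    using Pcard by (simp add: card_Un_disjoint)
  define full where "full p = Inr x # p @ [Inr y]" for p :: "bvertex list"
  have full_edge: "E g i (full p ! i) (full p ! Suc i)" if p: "p \<in> P g" and i: "i < 2 * k" for p g i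
  proof -
    have "i = 0 \<or> i = 2 * k - 1 \<or> i = Suc (i - 1) \<and> i - 1 < l"
      using i unfolding l_def by linarith
    then consider "i = 0" | "i = 2 * k - 1" | j where "i = Suc j" "j < l" by blast
    then show ?thesis
    proof cases
      case 1
      obtain a where a: "p ! 0 = Inl a" "a \<in> S g" using PL[OF p, of 0] by (auto simp: L_def V_def)
      have "a < m" "Q a x = g" using S2[OF a(2)] qm by auto
      then show ?thesis using 1 a(1) Plen[OF p] xy E_rl[of a x g 0] by (simp add: full_def nth_append)
    next
      case 2
      \<comment> \<open>The last edge has the odd index \<open>2 * k - 1\<close>, so its prescribed
        value is \<open>\<not> g\<close>, the one for which \<open>T g\<close> was chosen.\<close>
      have "even l" "l div 2 = k - 1" "k - 1 \<noteq> 0" using k unfolding l_def by presburger+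
      then have "L g l = Inl ` T g" by (simp add: L_def V_def)
      then have "p ! l \<in> Inl ` T g" using PL[OF p, of l] by simp
      then obtain a where a: "p ! l = Inl a" "a \<in> T g" by blast
      have "a < m" "Q a y = (\<not> g)" using T2[OF a(2)] qm by auto
      moreover have "i = Suc l" "odd i" using 2 k unfolding l_def by presburger+
      ultimately show ?thesis using a(1) Plen[OF p] xy E_lr[of a y g i]
        by (simp add: full_def nth_append)
    next
      case 3
      then show ?thesis using PE[OF p, of j] Plen[OF p] by (simp add: full_def nth_append)
    qed
  qed
  have path: "path_between (Kbip_edges m n) (Inr x) (Inr y) (2 * k) (full p) \<and> alternating c (full p)"
    if p: "p \<in> P g" for p g
  proof -
    have len: "length (full p) = 2 * k + 1" using Plen[OF p] k by (simp add: full_def l_def)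
    have "distinct p"
    proof (subst distinct_conv_nth, intro allI impI)
      fix i j assume "i < length p" "j < length p" "i \<noteq> j"
      then have "i \<le> l" "j \<le> l" using Plen[OF p] by auto
      then show "p ! i \<noteq> p ! j"
        using PL[OF p, of i] PL[OF p, of j] Ldisj[of i j g g] \<open>i \<noteq> j\<close> by auto
    qed
    then have "distinct (full p)" using Pset[OF p] Lxy[of _ g] xy(3) by (auto simp: full_def)
    moreover have "alternating c (full p)"
      unfolding alternating_def
    proof (intro allI impI)
      fix i assume "i + 2 < length (full p)"
      then have "E g i (full p ! i) (full p ! Suc i)"
        "E g (Suc i) (full p ! Suc i) (full p ! Suc (Suc i))"
        using full_edge[OF p] len by auto
      then show "c {full p ! i, full p ! (i + 1)} \<noteq> c {full p ! (i + 1), full p ! (i + 2)}"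
        by (auto simp: E_def col_def)
    qed
    moreover have "\<forall>i<2 * k. {full p ! i, full p ! (i + 1)} \<in> Kbip_edges m n"
      using full_edge[OF p] by (simp add: E_def)
    ultimately show ?thesis using len by (simp add: path_between_def full_def)
  qed
  have "inj_on full (P True \<union> P False)" by (auto simp: inj_on_def full_def)
  then have "card (full ` (P True \<union> P False)) = 2 * (s - (2 * k - 2) * e)"
    using cU by (simp add: card_image l_def)
  moreover have "internally_disjoint (Inr x) (Inr y) (full ` (P True \<union> P False))"
    unfolding internally_disjoint_def
  proof (intro ballI impI)
    fix u v assume "u \<in> full ` (P True \<union> P False)" "v \<in> full ` (P True \<union> P False)" "u \<noteq> v"
    then obtain p p' g g' where "u = full p" "v = full p'" "p \<in> P g" "p' \<in> P g'" "p \<noteq> p'" by blast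
    then show "set u \<inter> set v \<subseteq> {Inr x, Inr y}" using Pdisj[of p g p' g'] by (auto simp: full_def)
  qed
  ultimately show ?thesis unfolding alt_connected_def using path Pcard(1)
    by (intro exI[of _ "full ` (P True \<union> P False)"]) auto
qed

section \<open>Bounds on \<open>kappa\<close> and the asymptotics\<close>

text \<open>Access to \<open>Max\<close> needs a finite nonempty set. The vertex count on the pair
  \<open>Inr 0\<close>, \<open>Inr 1\<close> bounds it, and 0 belongs to it through the empty family
  of paths.\<close>

lemma
  assumes "n \<ge> 2" "k \<ge> 1" "r \<ge> 1"
  shows kappa_le: "kappa r (2 * k) m n * k \<le> m"
    and kappa_ge: "\<lbrakk>edge_coloring r (Kbip_edges m n) c;
      \<And>x y. x < n \<Longrightarrow> y < n \<Longrightarrow> x \<noteq> y \<Longrightarrow> alt_connected (Kbip_edges m n) c (2 * k) t (Inr x) (Inr y)\<rbrakk>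
      \<Longrightarrow> t \<le> kappa r (2 * k) m n"
proof -
  define K where "K = {t. \<exists>c. edge_coloring r (Kbip_edges m n) c \<and>
     (\<forall>x \<in> Inr ` {..<n}. \<forall>y \<in> Inr ` {..<n}. x \<noteq> y \<longrightarrow>
        alt_connected (Kbip_edges m n) c (2 * k) t x y)}"
  have bound: "t * k \<le> m" if t: "t \<in> K" for t
  proof -
    obtain c where "alt_connected (Kbip_edges m n) c (2 * k) t (Inr 0) (Inr 1)"
      using t assms(1) by (force simp: K_def)
    then show ?thesis by (rule alt_connected_Kbip_bound)
  qed
  have "t \<le> m" if "t \<in> K" for t
    using bound[OF that] assms(2) by (metis le_trans mult_le_mono2 nat_mult_1_right)
  then have fin: "finite K" by (meson finite_nat_set_iff_bounded_le)
  have "0 \<in> K"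
    using assms(3) by (auto simp: K_def edge_coloring_def alt_connected_def internally_disjoint_def
      intro!: exI[of _ "\<lambda>_. 1"])
  then have "Max K \<in> K" using fin Max_in by blast
  then show "kappa r (2 * k) m n * k \<le> m" using bound by (simp add: kappa_def K_def)
  assume "edge_coloring r (Kbip_edges m n) c" "\<And>x y. x < n \<Longrightarrow> y < n \<Longrightarrow> x \<noteq> y \<Longrightarrow>
    alt_connected (Kbip_edges m n) c (2 * k) t (Inr x) (Inr y)"
  then have "t \<in> K" by (auto simp: K_def)
  then show "t \<le> kappa r (2 * k) m n" using fin Max_ge by (simp add: kappa_def K_def)
qed

text \<open>The term \<open>6 * real k\<close> collects the rounding: at most
  \<open>4 * real k\<close> from replacing \<open>\<epsilon> * m\<close> by the integer
  \<open>e\<close>, and 2 from the floor in \<open>s\<close>.\<close>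

lemma kappa_lower_bound:
  fixes \<epsilon> :: real
  assumes "r \<ge> 2" "k \<ge> 2" "\<epsilon> > 0"
  shows "\<exists>m0. \<forall>m\<ge>m0. \<forall>n\<ge>m. real m / real k - 4 * real k * (\<epsilon> * m) - 6 * real k \<le> kappa r (2 * k) m n"
proof -
  obtain m0 where m0: "\<forall>m\<ge>m0. \<exists>Q :: nat \<Rightarrow> nat \<Rightarrow> bool.
    (\<forall>p j. Q (2 * p) j \<noteq> Q (2 * p + 1) j) \<and>
    (\<forall>X Y b. X \<subseteq> {..<m} \<longrightarrow> Y \<subseteq> {..<m} \<longrightarrow> \<epsilon> * m \<le> card X \<longrightarrow> \<epsilon> * m \<le> card Y \<longrightarrow>
      (\<exists>i\<in>X. \<exists>j\<in>Y. Q i j = b))"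
    using pseudorandom_bicoloring[OF assms(3)] ..
  have "real m / real k - 4 * real k * (\<epsilon> * m) - 6 * real k \<le> kappa r (2 * k) m n"
    if m: "m \<ge> max m0 (2 * k)" and n: "n \<ge> m" for m n
  proof -
    have "m \<ge> m0" using m by simp
    obtain Q :: "nat \<Rightarrow> nat \<Rightarrow> bool" where Q: "\<forall>p j. Q (2 * p) j \<noteq> Q (2 * p + 1) j"
      "\<forall>X Y b. X \<subseteq> {..<m} \<longrightarrow> Y \<subseteq> {..<m} \<longrightarrow> \<epsilon> * m \<le> card X \<longrightarrow> \<epsilon> * m \<le> card Y \<longrightarrow>
        (\<exists>i\<in>X. \<exists>j\<in>Y. Q i j = b)"
      using m0[rule_format, OF \<open>m \<ge> m0\<close>] by (elim exE conjE)
    define e where "e = nat \<lceil>\<epsilon> * m\<rceil>"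
    define s where "s = m div (2 * k)"
    define c :: "bvertex set \<Rightarrow> nat" where
      "c w = (if \<exists>i j. w = {Inl i, Inr j} \<and> Q i j then 1 else 2)" for w
    have c: "c {Inl i, Inr j} = (if Q i j then 1 else 2)" for i j
      by (auto simp: c_def doubleton_eq_iff)
    have e: "\<epsilon> * m \<le> real e" "real e \<le> \<epsilon> * m + 1"
      using mult_nonneg_nonneg[of \<epsilon> "real m"] assms(3) unfolding e_def by linarith+
    have s1: "s \<ge> 1" using m assms(2) by (simp add: s_def div_greater_zero_iff Suc_le_eq)
    have con: "alt_connected (Kbip_edges m n) c (2 * k) (2 * (s - (2 * k - 2) * e)) (Inr x) (Inr y)"
      if xy: "x < n" "y < n" "x \<noteq> y" for x y
    proof (rule alt_connected_of_pseudorandom[where Q = Q, OF assms(2) n s_def s1 c _ _ xy])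
      show "Q (2 * p) j \<noteq> Q (2 * p + 1) j" for p j using Q(1) by blast
      show "\<exists>i\<in>X. \<exists>j\<in>Y. Q i j = b"
        if "X \<subseteq> {..<m}" "Y \<subseteq> {..<m}" "e \<le> card X" "e \<le> card Y" for X Y b
      proof -
        have "\<epsilon> * m \<le> card X" "\<epsilon> * m \<le> card Y" using that(3,4) e(1) by linarith+
        then show ?thesis using Q(2) that(1,2) by blast
      qed
    qed
    have "2 * (s - (2 * k - 2) * e) \<le> kappa r (2 * k) m n"
    proof (rule kappa_ge[OF _ _ _ _ con])
      show "edge_coloring r (Kbip_edges m n) c" using assms(1) by (simp add: edge_coloring_def c_def)
    qed (use m n assms in auto)
    \<comment> \<open>Names for the nonlinear terms leave a linear problem; truncated subtraction
      only helps, as \<open>t\<close> is at least \<open>real s - B\<close>.\<close>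
    define t where "t = real (s - (2 * k - 2) * e)"
    define B where "B = real ((2 * k - 2) * e)"
    define w where "w = real k * (\<epsilon> * m)"
    have "real (2 * (s - (2 * k - 2) * e)) \<le> kappa r (2 * k) m n"
      using \<open>2 * (s - (2 * k - 2) * e) \<le> _\<close> by (simp only: of_nat_le_iff)
    then have "2 * t \<le> kappa r (2 * k) m n" by (simp only: t_def of_nat_mult of_nat_numeral)
    moreover have "real s - B \<le> t" unfolding t_def B_def by linarith
    moreover have "B \<le> 2 * w + 2 * real k"
    proof -
      have "B \<le> real (2 * k) * (\<epsilon> * m + 1)"
        unfolding B_def of_nat_mult by (rule mult_mono) (use e(2) in auto)
      then show ?thesis by (simp add: w_def algebra_simps)
    qed
    moreover have "real m / real k - 2 \<le> 2 * real s"
    proof -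
      have "real s = of_int \<lfloor>real m / real (2 * k)\<rfloor>"
        unfolding s_def floor_divide_of_nat_eq by simp
      then have "real m / (2 * real k) - 1 \<le> real s" by simp
      then show ?thesis by simp
    qed
    ultimately have "real m / real k - 4 * w - 6 * real k \<le> kappa r (2 * k) m n"
      using assms(2) by linarith
    then show ?thesis by (simp add: w_def mult.assoc)
  qed
  then show ?thesis by (intro exI[of _ "max m0 (2 * k)"] allI impI)
qed

theorem theorem3p1:
  fixes r k :: nat and m :: "nat \<Rightarrow> nat"
  assumes "r \<ge> 2" and "k \<ge> 2"
    and "\<And>n. m n \<le> n"
    and "filterlim m at_top at_top"
  shows "(\<lambda>n. real (kappa r (2 * k) (m n) n)) \<sim>[at_top] (\<lambda>n. real (m n) / real k)"
proof (rule asymp_equivI', rule tendstoI)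
  fix \<delta> :: real assume \<delta>: "\<delta> > 0"
  \<comment> \<open>After multiplication by \<open>k\<close>, the error
    \<open>4 * real k * (\<epsilon> * M)\<close> becomes \<open>\<delta> / 2 * M\<close>.\<close>
  define \<epsilon> where "\<epsilon> = \<delta> / (8 * (real k)\<^sup>2)"
  have k0: "real k > 0" using assms(2) by simp
  have "\<epsilon> > 0" using \<delta> k0 by (simp add: \<epsilon>_def)
  from kappa_lower_bound[OF assms(1,2) this] obtain m0 where
    m0: "\<forall>m\<ge>m0. \<forall>n\<ge>m. real m / real k - 4 * real k * (\<epsilon> * m) - 6 * real k \<le> kappa r (2 * k) m n" ..
  \<comment> \<open>Beyond \<open>m1\<close> the constant error \<open>6 * (real k)\<^sup>2\<close>
    is below the other half, \<open>\<delta> / 2 * M\<close>.\<close>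
  obtain m1 :: nat where m1: "12 * (real k)\<^sup>2 / \<delta> < m1" using reals_Archimedean2 by blast
  have "\<forall>\<^sub>F n in at_top. m n \<ge> max (max m0 m1) 2"
    using assms(4) by (simp only: filterlim_at_top)
  then show "\<forall>\<^sub>F n in at_top. dist (real (kappa r (2 * k) (m n) n) / (real (m n) / real k)) 1 < \<delta>"
  proof (rule eventually_mono)
    fix n assume n: "m n \<ge> max (max m0 m1) 2"
    define M where "M = real (m n)"
    define K where "K = real (kappa r (2 * k) (m n) n)"
    have M0: "M > 0" using n by (simp add: M_def)
    have M1: "12 * (real k)\<^sup>2 / \<delta> < M" using n m1 by (simp add: M_def)
    have "n \<ge> 2" using n assms(3)[of n] by simp
    then have "kappa r (2 * k) (m n) n * k \<le> m n"
      by (rule kappa_le) (use assms in auto)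
    then have "real (kappa r (2 * k) (m n) n * k) \<le> M" unfolding M_def by (simp only: of_nat_le_iff)
    then have up: "K * k \<le> M" by (simp add: K_def)
    have "M / real k - 4 * real k * (\<epsilon> * M) - 6 * real k \<le> K"
      using m0 n assms(3)[of n] by (simp add: M_def K_def)
    then have "(M / real k - 4 * real k * (\<epsilon> * M) - 6 * real k) * k \<le> K * k"
      by (rule mult_right_mono) simp
    moreover have "(M / real k - 4 * real k * (\<epsilon> * M) - 6 * real k) * k = M - \<delta> / 2 * M - 6 * (real k)\<^sup>2"
      using k0 by (simp add: \<epsilon>_def power2_eq_square field_simps)
    moreover have "12 * (real k)\<^sup>2 < \<delta> * M" using M1 \<delta> by (simp add: pos_divide_less_eq mult.commute)
    ultimately have lo: "M - \<delta> * M < K * k" by simp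
    have "K / (M / k) \<le> 1" using up M0 by simp
    moreover have "1 - \<delta> < K / (M / k)"
      using lo M0 by (simp add: field_simps)
    ultimately show "dist (real (kappa r (2 * k) (m n) n) / (real (m n) / real k)) 1 < \<delta>"
      by (simp add: dist_real_def K_def M_def)
  qed
qed

end
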